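(* Let $(W_{s,t})_{s,t\in[0,1]}$ be a real-valued Wiener sheet and let $$\xi(x)=\delta^{(2)}_{(u_1,v_1),(u_2,v_2)}\Big(\Delta(x-W_{u_1,v_2})\,1_{[0,u_1]}(u_2)\,1_{[0,v_2]}(v_1)\Big),\qquad x\in\mathbb{R},$$ be the 2D-stochastic current over $W$. Then for every $x\in\mathbb{R}$ the functional $\xi(x)$ belongs to the Sobolev-Watanabe space $\mathbb{D}^{-\alpha,2}$ for every $\alpha>\frac12$.
   Context: Wiener sheet: a real centered Gaussian process $(W_{s,t})_{s,t\in[0,1]}$ with $\mathbf{E}[W_{s,t}W_{s',t'}]=(s\wedge s')(t\wedge t')$. It is identified with the isonormal Gaussian process over $\mathcal{H}=L^2([0,1]^2)$ via $W_{s,t}=W(1_{[0,s]\times[0,t]})$. $I_n$ is the multiple Wiener-Itô integral of order $n$ with respect to $W$, with $I_n(f)=I_n(\tilde f)$ ($\tilde f$ the symmetrization of $f\in L^2(([0,1]^2)^n)$, which averages over all permutations of the $n$ variables in $[0,1]^2$) and $\mathbf{E}[I_n(f)I_m(g)]=\mathbf 1_{n=m}\,n!\,\langle \tilde f,\tilde g\rangle_{L^2(([0,1]^2)^n)}$. Sobolev-Watanabe spaces: for $\beta\in\mathbb{R}$, a (possibly formal) chaos series $F=\sum_{n\ge0}I_n(f_n)$ with symmetric $f_n\in L^2(([0,1]^2)^n)$ belongs to $\mathbb{D}^{\beta,2}$ if and only if $\|F\|_{\beta,2}^2:=\sum_{n\ge0}(1+n)^{\beta}\,n!\,\|f_n\|^2_{L^2(([0,1]^2)^n)}<\infty$.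 For $\beta<0$ the elements are in general distributions (Watanabe distributions), not random variables. Dirac functional: with Hermite polynomials $H_m(y)=\frac{(-1)^m}{m!}e^{y^2/2}\frac{d^m}{dy^m}e^{-y^2/2}$ and $p_s(x)=\frac{1}{\sqrt{2\pi s}}e^{-x^2/(2s)}$, one has $$\Delta(x-W_{u,v})=\sum_{m\ge0}a_m^x(u,v)\,I_m\big(1_{[0,u]\times[0,v]}^{\otimes m}\big),\qquad a_m^x(u,v)=(uv)^{-m/2}p_{uv}(x)H_m\Big(\frac{x}{\sqrt{uv}}\Big),$$ for $u,v\in(0,1]$. Double Skorohod integral: $\delta^{(2)}_{(u_1,v_1),(u_2,v_2)}$ is the twice iterated Skorohod (divergence) integral with respect to $W$ in the variables $(u_1,v_1),(u_2,v_2)\in[0,1]^2$. On chaos expansions it acts as follows: if $F_{z_1,z_2}=\sum_{m\ge0}I_m(f_m(\cdot\,;z_1,z_2))$ with $z_1,z_2\in[0,1]^2$, then $\delta^{(2)}(F)=\sum_{m\ge0}I_{m+2}(\tilde f_m)$, where $\tilde f_m$ is the symmetrization of $f_m$ in all its $m+2$ variables. Thus $\xi(x)$ is the chaos series obtained by applying this rule to the expansion of $\Delta(x-W_{u_1,v_2})\,1_{[0,u_1]}(u_2)\,1_{[0,v_2]}(v_1)$, with $z_1=(u_1,v_1)$, $z_2=(u_2,v_2)$. *)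

theory Defs
  imports "HOL-Probability.Probability" "HOL-Combinatorics.Permutations"
begin

definition centered_gaussian :: "'a measure \<Rightarrow> ('a \<Rightarrow> real) \<Rightarrow> bool" where
  "centered_gaussian M X \<longleftrightarrow> X \<in> borel_measurable M \<and>
     ((AE \<omega> in M. X \<omega> = 0) \<or> (\<exists>\<sigma>>0. distributed M lborel X (normal_density 0 \<sigma>)))"

text \<open>Being a centered Gaussian process is expressed by all finite linear combinations of the
  variables being centered Gaussian (possibly degenerate). Only the values of \<open>W\<close> at times
  in the unit square are constrained.\<close>

locale wiener_sheet = prob_space M for M :: "'a measure" +
  fixes W :: "real \<Rightarrow> real \<Rightarrow> 'a \<Rightarrow> real"
  assumes gaussian:
    "\<And>T c. finite T \<Longrightarrow> T \<subseteq> {0..1} \<times> {0..1} \<Longrightarrow>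
       centered_gaussian M (\<lambda>\<omega>. \<Sum>(s, t)\<in>T. c (s, t) * W s t \<omega>)"
  and covariance:
    "\<And>s t s' t'. s \<in> {0..1} \<Longrightarrow> t \<in> {0..1} \<Longrightarrow> s' \<in> {0..1} \<Longrightarrow> t' \<in> {0..1} \<Longrightarrow>
       expectation (\<lambda>\<omega>. W s t \<omega> * W s' t' \<omega>) = min s s' * min t t'"

text \<open>A kernel of order \<open>n\<close> is a function of \<open>w 0, \<dots>, w (n - 1)\<close>, points of the unit square.\<close>

type_synonym kernel = "(nat \<Rightarrow> real \<times> real) \<Rightarrow> real"

definition unit_square :: "(real \<times> real) measure" where
  "unit_square = restrict_space lborel ({0..1} \<times> {0..1})"

definition kernel_measure :: "nat \<Rightarrow> (nat \<Rightarrow> real \<times> real) measure" where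
  "kernel_measure n = (\<Pi>\<^sub>M i\<in>{..<n}. unit_square)"

definition square_integrable :: "'b measure \<Rightarrow> ('b \<Rightarrow> real) \<Rightarrow> bool" where
  "square_integrable M f \<longleftrightarrow> f \<in> borel_measurable M \<and> integrable M (\<lambda>x. (f x)\<^sup>2)"

definition L2_norm_sq :: "'b measure \<Rightarrow> ('b \<Rightarrow> real) \<Rightarrow> real" where
  "L2_norm_sq M f = (\<integral>x. (f x)\<^sup>2 \<partial>M)"

definition symmetrization :: "nat \<Rightarrow> kernel \<Rightarrow> kernel" where
  "symmetrization n f = (\<lambda>w. (\<Sum>\<pi> | \<pi> permutes {..<n}. f (w \<circ> \<pi>)) / fact n)"

definition symmetric_kernel :: "nat \<Rightarrow> kernel \<Rightarrow> bool" where
  "symmetric_kernel n f \<longleftrightarrow>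
     (\<forall>\<pi>. \<pi> permutes {..<n} \<longrightarrow> (AE w in kernel_measure n. f (w \<circ> \<pi>) = f w))"

definition rectangle :: "real \<times> real \<Rightarrow> real \<times> real \<Rightarrow> (real \<times> real) set" where
  "rectangle a b = {fst a<..fst b} \<times> {snd a<..snd b}"

text \<open>For \<open>a \<le> b\<close> componentwise this is \<open>W(1\<^sub>R)\<close> with \<open>R = rectangle a b\<close>.\<close>

definition sheet_increment ::
    "(real \<Rightarrow> real \<Rightarrow> 'a \<Rightarrow> real) \<Rightarrow> real \<times> real \<Rightarrow> real \<times> real \<Rightarrow> 'a \<Rightarrow> real" where
  "sheet_increment W a b \<omega> =
     W (fst b) (snd b) \<omega> - W (fst a) (snd b) \<omega> - W (fst b) (snd a) \<omega> + W (fst a) (snd a) \<omega>"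

text \<open>\<open>elementary_integral W n g Y\<close>: \<open>g\<close> is a linear combination of indicators of products of
  pairwise different members of a finite disjoint family of rectangles, so that \<open>g\<close> vanishes on
  the diagonals, and \<open>Y\<close> is obtained by replacing each indicator by the increment of \<open>W\<close>.\<close>

definition elementary_integral ::
    "(real \<Rightarrow> real \<Rightarrow> 'a \<Rightarrow> real) \<Rightarrow> nat \<Rightarrow> kernel \<Rightarrow> ('a \<Rightarrow> real) \<Rightarrow> bool" where
  "elementary_integral W n g Y \<longleftrightarrow>
     (\<exists>(N :: nat) a b c.
        (\<forall>i<N. 0 \<le> fst (a i) \<and> fst (a i) \<le> fst (b i) \<and> fst (b i) \<le> 1 \<and>
               0 \<le> snd (a i) \<and> snd (a i) \<le> snd (b i) \<and> snd (b i) \<le> 1) \<and>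
        disjoint_family_on (\<lambda>i. rectangle (a i) (b i)) {..<N} \<and>
        g = (\<lambda>w. \<Sum>j \<in> {j \<in> {..<n} \<rightarrow>\<^sub>E {..<N}. inj_on j {..<n}}.
               c j * (\<Prod>i<n. indicator (rectangle (a (j i)) (b (j i))) (w i))) \<and>
        Y = (\<lambda>\<omega>. \<Sum>j \<in> {j \<in> {..<n} \<rightarrow>\<^sub>E {..<N}. inj_on j {..<n}}.
               c j * (\<Prod>i<n. sheet_increment W (a (j i)) (b (j i)) \<omega>)))"

definition has_multiple_integral ::
    "'a measure \<Rightarrow> (real \<Rightarrow> real \<Rightarrow> 'a \<Rightarrow> real) \<Rightarrow> nat \<Rightarrow> kernel \<Rightarrow> ('a \<Rightarrow> real) \<Rightarrow> bool" where
  "has_multiple_integral M W n f X \<longleftrightarrow>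
     square_integrable (kernel_measure n) f \<and> square_integrable M X \<and>
     (\<exists>g Y. (\<forall>k. elementary_integral W n (g k) (Y k)) \<and>
        (\<lambda>k. L2_norm_sq (kernel_measure n) (\<lambda>w. g k w - f w)) \<longlonglongrightarrow> 0 \<and>
        (\<lambda>k. L2_norm_sq M (\<lambda>\<omega>. Y k \<omega> - X \<omega>)) \<longlonglongrightarrow> 0)"

text \<open>\<open>I\<^sub>n(f)\<close>. Since the elementary integrals satisfy the Ito isometry and the elementary kernels
  are dense, over a Wiener sheet a square integrable \<open>f\<close> has an integral and it is unique up to
  almost sure equality; the definition picks one version.\<close>

definition multiple_integral ::
    "'a measure \<Rightarrow> (real \<Rightarrow> real \<Rightarrow> 'a \<Rightarrow> real) \<Rightarrow> nat \<Rightarrow> kernel \<Rightarrow> 'a \<Rightarrow> real" where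
  "multiple_integral M W n f = (SOME X. has_multiple_integral M W n f X)"

text \<open>A formal chaos series over \<open>W\<close> is given by the sequence of its terms \<open>I\<^sub>n(f\<^sub>n)\<close>; no
  convergence of the sum is required.\<close>

definition chaos_series ::
    "'a measure \<Rightarrow> (real \<Rightarrow> real \<Rightarrow> 'a \<Rightarrow> real) \<Rightarrow> (nat \<Rightarrow> kernel) \<Rightarrow> nat \<Rightarrow> 'a \<Rightarrow> real" where
  "chaos_series M W f = (\<lambda>n. multiple_integral M W n (f n))"

definition sobolev_watanabe ::
    "'a measure \<Rightarrow> (real \<Rightarrow> real \<Rightarrow> 'a \<Rightarrow> real) \<Rightarrow> real \<Rightarrow> (nat \<Rightarrow> 'a \<Rightarrow> real) set" where
  "sobolev_watanabe M W \<beta> = {F. \<exists>f.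
     (\<forall>n. square_integrable (kernel_measure n) (f n) \<and> symmetric_kernel n (f n)) \<and>
     (\<forall>n. AE \<omega> in M. F n \<omega> = chaos_series M W f n \<omega>) \<and>
     summable (\<lambda>n. (1 + real n) powr \<beta> * fact n * L2_norm_sq (kernel_measure n) (f n))}"

definition hermite :: "nat \<Rightarrow> real \<Rightarrow> real" where
  "hermite m y = (-1) ^ m / fact m * exp (y\<^sup>2 / 2) * (deriv ^^ m) (\<lambda>z. exp (- z\<^sup>2 / 2)) y"

definition heat_kernel :: "real \<Rightarrow> real \<Rightarrow> real" where
  "heat_kernel s x = 1 / sqrt (2 * pi * s) * exp (- x\<^sup>2 / (2 * s))"

definition dirac_coeff :: "nat \<Rightarrow> real \<Rightarrow> real \<Rightarrow> real \<Rightarrow> real" where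
  "dirac_coeff m x u v =
     (u * v) powr (- real m / 2) * heat_kernel (u * v) x * hermite m (x / sqrt (u * v))"

text \<open>The kernels of the chaos expansion of \<open>\<Delta>(x - W\<^bsub>u,v\<^esub>)\<close>. The formula is meant
  for \<open>u, v > 0\<close>; the value at the null set where \<open>u = 0\<close> or \<open>v = 0\<close> is immaterial.\<close>

definition dirac_expansion :: "real \<Rightarrow> real \<Rightarrow> real \<Rightarrow> nat \<Rightarrow> kernel" where
  "dirac_expansion x u v m =
     (\<lambda>w. dirac_coeff m x u v * (\<Prod>i<m. indicator ({0..u} \<times> {0..v}) (w i)))"

text \<open>The integrand is a family of formal chaos series \<open>F z\<^sub>1 z\<^sub>2\<close> given by kernels
  \<open>f z\<^sub>1 z\<^sub>2 m\<close> of order \<open>m\<close>. As a function of \<open>m + 2\<close> points, this kernel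
  has \<open>z\<^sub>1\<close> and \<open>z\<^sub>2\<close> as its last two arguments. The terms of order 0 and 1 of the
  double integral are zero.\<close>

fun double_skorohod ::
    "(real \<times> real \<Rightarrow> real \<times> real \<Rightarrow> nat \<Rightarrow> kernel) \<Rightarrow> nat \<Rightarrow> kernel" where
  "double_skorohod f 0 = (\<lambda>w. 0)"
| "double_skorohod f (Suc 0) = (\<lambda>w. 0)"
| "double_skorohod f (Suc (Suc m)) =
     symmetrization (m + 2) (\<lambda>w. f (w m) (w (m + 1)) m (restrict w {..<m}))"

definition current_integrand ::
    "real \<Rightarrow> real \<times> real \<Rightarrow> real \<times> real \<Rightarrow> nat \<Rightarrow> kernel" where
  "current_integrand x = (\<lambda>(u\<^sub>1, v\<^sub>1) (u\<^sub>2, v\<^sub>2) m w.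
     dirac_expansion x u\<^sub>1 v\<^sub>2 m w * indicator {0..u\<^sub>1} u\<^sub>2 * indicator {0..v\<^sub>2} v\<^sub>1)"

definition stochastic_current ::
    "'a measure \<Rightarrow> (real \<Rightarrow> real \<Rightarrow> 'a \<Rightarrow> real) \<Rightarrow> real \<Rightarrow> nat \<Rightarrow> 'a \<Rightarrow> real" where
  "stochastic_current M W x = chaos_series M W (double_skorohod (current_integrand x))"

end

theory Submission imports Defs begin

text \<open>
Write \<open>n = m + 2\<close> and let \<open>f\<close> be the unsymmetrized kernel of order \<open>n\<close>, whose
arguments \<open>m\<close> and \<open>m + 1\<close> are the integration points \<open>(u\<^sub>1, v\<^sub>1)\<close> and \<open>(u\<^sub>2, v\<^sub>2)\<close>.
The indicators in the Dirac expansion and those in the integrand together confine \<open>f\<close> to the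
configurations in which point \<open>m\<close> has the largest first coordinate and point \<open>m + 1\<close> the
largest second coordinate among all \<open>n\<close> points. Almost surely all coordinates are distinct,
so each maximum is attained at one point only, and two permuted copies of \<open>f\<close> overlap only if
the two permutations put the same points at these two places, in which case the copies coincide
(\<open>current_kernel_orthogonal\<close>, \<open>current_kernel_permute_agree\<close>). Symmetrization therefore costs
exactly the proportion \<open>m! / n!\<close> of such permutations, and
\<open>n! \<parallel>f\<^sub>s\<^sub>y\<^sub>m\<parallel>\<^sup>2 = m! \<parallel>f\<parallel>\<^sup>2\<close>. The crude bound by \<open>n! \<parallel>f\<parallel>\<^sup>2\<close>
would lose a factor of order \<open>m\<^sup>2\<close>.

Integrating out the \<open>m\<close> free points produces \<open>(u\<^sub>1 v\<^sub>2)\<^sup>m\<close>, which cancels the singular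
power in the Dirac coefficient. With \<open>y = x / sqrt (u\<^sub>1 v\<^sub>2)\<close> what remains of \<open>m! f\<^sup>2\<close> is
\<open>(2 \<pi> u\<^sub>1 v\<^sub>2)\<^sup>-\<^sup>1 m! (H\<^sub>m(y) exp (- y\<^sup>2 / 2))\<^sup>2\<close>, and the two triangular
indicators compensate the factor \<open>(u\<^sub>1 v\<^sub>2)\<^sup>-\<^sup>1\<close>, as the integral of \<open>1 / u\<close> over
\<open>0 \<le> s \<le> u \<le> 1\<close> is one.

The decay in \<open>m\<close> comes from a bound on the derivatives \<open>D\<^sub>m\<close> of \<open>exp (- y\<^sup>2 / 2)\<close> that is
uniform in \<open>y\<close>, namely \<open>D\<^sub>m\<^sup>2 \<le> m! / sqrt (m + 1)\<close>
(\<open>gaussian_deriv_bound\<close>). The recurrence of the \<open>D\<^sub>m\<close> is a damped oscillator equation, whose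
energy \<open>D\<^sub>m\<^sub>+\<^sub>1\<^sup>2 + (m + 1) D\<^sub>m\<^sup>2\<close> is largest at the origin, where it can be computed.
In total the term of order \<open>n\<close> of the squared norm is at most
\<open>(m + 1)\<^sup>-\<^sup>\<alpha>\<^sup>-\<^sup>1\<^sup>/\<^sup>2\<close>, which is summable exactly for \<open>\<alpha> > 1 / 2\<close>.
\<close>

section \<open>A uniform bound for the derivatives of the Gaussian\<close>

definition gaussian_deriv :: "nat \<Rightarrow> real \<Rightarrow> real" where
  "gaussian_deriv m = (deriv ^^ m) (\<lambda>z. exp (- z\<^sup>2 / 2))"

text \<open>Differentiability of each derivative and the three-term recurrence are proved together, because
the recurrence at one order is what exhibits the derivative at the next.\<close>

lemma gaussian_deriv_step:
  "(\<forall>y. (gaussian_deriv m has_real_derivative gaussian_deriv (Suc m) y) (at y)) \<and>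
   (\<forall>y. (gaussian_deriv (Suc m) has_real_derivative
          - y * gaussian_deriv (Suc m) y - (real m + 1) * gaussian_deriv m y) (at y))"
proof (induction m)
  case 0
  have d0: "(gaussian_deriv 0 has_real_derivative - y * gaussian_deriv 0 y) (at y)" for y
    unfolding gaussian_deriv_def
    by (auto intro!: derivative_eq_intros simp: power2_eq_square)
  hence d1: "gaussian_deriv (Suc 0) = (\<lambda>y. - y * gaussian_deriv 0 y)"
    by (auto simp: gaussian_deriv_def intro!: DERIV_imp_deriv ext)
  have "((\<lambda>y. - y * gaussian_deriv 0 y) has_real_derivative
          - y * (- y * gaussian_deriv 0 y) - 1 * gaussian_deriv 0 y) (at y)" for y
    by (rule derivative_eq_intros d0 refl | simp)+
  thus ?case using d0 by (simp add: d1)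
next
  case (Suc m)
  have e: "gaussian_deriv (Suc (Suc m)) =
      (\<lambda>y. - y * gaussian_deriv (Suc m) y - (real m + 1) * gaussian_deriv m y)"
    using Suc by (auto simp: gaussian_deriv_def intro!: DERIV_imp_deriv ext)
  have d0: "(gaussian_deriv m has_real_derivative gaussian_deriv (Suc m) y) (at y)" for y
    using Suc by blast
  have d1: "(gaussian_deriv (Suc m) has_real_derivative gaussian_deriv (Suc (Suc m)) y) (at y)" for y
    using Suc e by simp
  have "((\<lambda>y. - y * gaussian_deriv (Suc m) y - (real m + 1) * gaussian_deriv m y)
      has_real_derivative
        - y * gaussian_deriv (Suc (Suc m)) y - (real (Suc m) + 1) * gaussian_deriv (Suc m) y) (at y)" for y
    by (rule derivative_eq_intros d0 d1 refl | simp add: algebra_simps)+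
  thus ?case using d1 by (simp only: e) auto
qed

lemma gaussian_deriv_has_derivative:
  "(gaussian_deriv m has_real_derivative gaussian_deriv (Suc m) y) (at y)"
  using gaussian_deriv_step by blast

lemma gaussian_deriv_recurrence:
  "gaussian_deriv (Suc (Suc m)) y = - y * gaussian_deriv (Suc m) y - (real m + 1) * gaussian_deriv m y"
  using gaussian_deriv_step[of m] gaussian_deriv_has_derivative[of "Suc m" y] DERIV_unique by blast

text \<open>The recurrence makes \<open>h = gaussian_deriv m\<close> a solution of \<open>h'' + y h' + (m + 1) h = 0\<close>, and this
is the kinetic plus the potential energy of that oscillator. The friction term \<open>y h'\<close> removes
energy when moving away from the origin in either direction.\<close>

definition gaussian_energy :: "nat \<Rightarrow> real \<Rightarrow> real" where
  "gaussian_energy m y = (gaussian_deriv (Suc m) y)\<^sup>2 + (real m + 1) * (gaussian_deriv m y)\<^sup>2"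

lemma gaussian_energy_derivative:
  "(gaussian_energy m has_real_derivative - 2 * y * (gaussian_deriv (Suc m) y)\<^sup>2) (at y)"
proof -
  have "((\<lambda>y. (gaussian_deriv (Suc m) y)\<^sup>2 + (real m + 1) * (gaussian_deriv m y)\<^sup>2)
     has_real_derivative - 2 * y * (gaussian_deriv (Suc m) y)\<^sup>2) (at y)"
    by (rule derivative_eq_intros gaussian_deriv_has_derivative refl |
        simp add: gaussian_deriv_recurrence power2_eq_square algebra_simps)+
  thus ?thesis by (simp only: gaussian_energy_def[abs_def])
qed

lemma gaussian_energy_le_at_0: "gaussian_energy m y \<le> gaussian_energy m 0"
proof (cases "y \<ge> 0")
  case True
  show ?thesis
    by (rule DERIV_nonpos_imp_nonincreasing[OF True])
       (metis gaussian_energy_derivative mult_nonneg_nonneg mult_minus_left neg_le_0_iff_le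
          zero_le_numeral zero_le_power2)
next
  case False
  show ?thesis
  proof (rule DERIV_nonneg_imp_nondecreasing[where f = "gaussian_energy m"])
    show "y \<le> 0" using False by simp
    fix x :: real assume "y \<le> x" "x \<le> 0"
    hence "0 \<le> - 2 * x * (gaussian_deriv (Suc m) x)\<^sup>2"
      by (intro mult_nonneg_nonneg[of "- 2 * x"]) simp_all
    thus "\<exists>d. (gaussian_energy m has_real_derivative d) (at x) \<and> d \<ge> 0"
      using gaussian_energy_derivative by blast
  qed
qed

lemma gaussian_deriv_odd_at_0: "gaussian_deriv (Suc (2 * k)) 0 = 0"
proof (induction k)
  case 0
  have "(gaussian_deriv 0 has_real_derivative 0) (at 0)"
    unfolding gaussian_deriv_def by (auto intro!: derivative_eq_intros)
  thus ?case using gaussian_deriv_has_derivative DERIV_unique by fastforce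
next
  case (Suc k)
  have "2 * Suc k = Suc (Suc (2 * k))" by simp
  thus ?case using gaussian_deriv_recurrence[of "Suc (2 * k)" 0] Suc by (simp only:)
qed

lemma gaussian_energy_odd:
  "gaussian_energy (Suc (2 * k)) 0 = (2 * real k + 1) * gaussian_energy (2 * k) 0"
  by (simp add: gaussian_energy_def gaussian_deriv_odd_at_0 gaussian_deriv_recurrence)
     (simp add: power2_eq_square algebra_simps)

lemma gaussian_energy_even:
  "gaussian_energy (2 * Suc k) 0 = (2 * real k + 3) * gaussian_energy (Suc (2 * k)) 0"
proof -
  have "gaussian_deriv (Suc (Suc (Suc (2 * k)))) 0 = 0"
    using gaussian_deriv_odd_at_0[of "Suc k"] by simp
  thus ?thesis
    by (simp add: gaussian_energy_def gaussian_deriv_odd_at_0)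
qed

text \<open>The square root is the Wallis asymptotics of \<open>gaussian_deriv (2 * k) 0 = \<plusminus> (2k - 1)!!\<close>. The
induction step amounts to \<open>(2k + 1) (2k + 3) \<le> (2k + 2)\<^sup>2\<close>.\<close>

lemma gaussian_energy_even_bound:
  "gaussian_energy (2 * k) 0 \<le> fact (2 * k) * sqrt (2 * real k + 1)"
proof (induction k)
  case 0
  have "gaussian_deriv (Suc 0) 0 = 0" using gaussian_deriv_odd_at_0[of 0] by simp
  thus ?case by (simp add: gaussian_energy_def) (simp add: gaussian_deriv_def)
next
  case (Suc k)
  let ?a = "2 * real k + 1"
  have "((?a + 2) * ?a * sqrt ?a)\<^sup>2 \<le> ((?a + 1) * ?a * sqrt (?a + 2))\<^sup>2"
  proof -
    have "(?a + 2) * ?a \<le> (?a + 1)\<^sup>2" by (simp add: power2_eq_square algebra_simps)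
    hence "((?a + 2) * ?a) * ((?a + 2) * ?a\<^sup>2) \<le> (?a + 1)\<^sup>2 * ((?a + 2) * ?a\<^sup>2)"
      by (rule mult_right_mono) simp
    thus ?thesis by (simp only: power_mult_distrib) (simp add: power2_eq_square mult_ac)
  qed
  hence *: "(?a + 2) * ?a * sqrt ?a \<le> (?a + 1) * ?a * sqrt (?a + 2)"
    by (rule power2_le_imp_le) simp
  have "gaussian_energy (2 * Suc k) 0 = ((?a + 2) * ?a) * gaussian_energy (2 * k) 0"
    by (simp only: gaussian_energy_even gaussian_energy_odd) (simp add: algebra_simps)
  also have "\<dots> \<le> ((?a + 2) * ?a) * (fact (2 * k) * sqrt ?a)"
    using Suc by (intro mult_left_mono) auto
  also have "\<dots> = fact (2 * k) * ((?a + 2) * ?a * sqrt ?a)" by (simp only: mult_ac)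
  also have "\<dots> \<le> fact (2 * k) * ((?a + 1) * ?a * sqrt (?a + 2))"
    using * by (intro mult_left_mono) auto
  also have "\<dots> = fact (2 * Suc k) * sqrt (2 * real (Suc k) + 1)"
    by (simp add: algebra_simps)
  finally show ?case .
qed

lemma gaussian_energy_bound: "gaussian_energy m 0 \<le> fact m * sqrt (real m + 1)"
proof (cases "even m")
  case True
  then obtain k where "m = 2 * k" by (elim evenE)
  thus ?thesis using gaussian_energy_even_bound[of k] by simp
next
  case False
  then obtain k where m: "m = Suc (2 * k)" by (metis oddE Suc_eq_plus1)
  have "gaussian_energy m 0 \<le> (2 * real k + 1) * (fact (2 * k) * sqrt (2 * real k + 1))"
    unfolding m gaussian_energy_odd
    by (intro mult_left_mono gaussian_energy_even_bound) auto
  also have "\<dots> = fact m * sqrt (2 * real k + 1)" by (simp add: m algebra_simps)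
  also have "\<dots> \<le> fact m * sqrt (real m + 1)" by (intro mult_left_mono) (auto simp: m)
  finally show ?thesis .
qed

text \<open>The order \<open>m! / sqrt m\<close> is attained at the origin for even \<open>m\<close>. The half power gained over
\<open>m!\<close> is what brings the critical regularity of the current from \<open>-1\<close> to \<open>-1 / 2\<close>.\<close>

lemma gaussian_deriv_bound: "(gaussian_deriv m y)\<^sup>2 \<le> fact m / sqrt (real m + 1)"
proof -
  have "(real m + 1) * (gaussian_deriv m y)\<^sup>2 \<le> gaussian_energy m y"
    by (simp add: gaussian_energy_def)
  also have "\<dots> \<le> fact m * sqrt (real m + 1)"
    using gaussian_energy_le_at_0 gaussian_energy_bound order_trans by blast
  finally have "(gaussian_deriv m y)\<^sup>2 \<le> fact m * sqrt (real m + 1) / (real m + 1)"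
    by (simp add: field_simps)
  also have "\<dots> = fact m / sqrt (real m + 1)"
    by (simp add: divide_simps flip: real_sqrt_mult) 
  finally show ?thesis .
qed

lemma hermite_eq_gaussian_deriv:
  "hermite m y = (-1) ^ m / fact m * exp (y\<^sup>2 / 2) * gaussian_deriv m y"
  by (simp add: hermite_def gaussian_deriv_def)

lemma hermite_measurable [measurable]: "hermite m \<in> borel_measurable borel"
proof -
  have "continuous_on UNIV (gaussian_deriv m)"
    by (intro DERIV_continuous_on) (rule gaussian_deriv_has_derivative)
  hence [measurable]: "gaussian_deriv m \<in> borel_measurable borel"
    by (rule borel_measurable_continuous_onI)
  show ?thesis unfolding hermite_eq_gaussian_deriv[abs_def] by measurable
qed

lemma dirac_coeff_measurable [measurable]:
  assumes [measurable]: "f \<in> borel_measurable N" "g \<in> borel_measurable N"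
  shows "(\<lambda>w. dirac_coeff m x (f w) (g w)) \<in> borel_measurable N"
  unfolding dirac_coeff_def heat_kernel_def by measurable

text \<open>The factor \<open>(u v)\<^sup>m\<close> is the volume left by the \<open>m\<close> free points of the kernel. One half of
the Gaussian weight in the heat kernel is used up in turning the Hermite polynomial into a
derivative of the Gaussian; squaring leaves precisely \<open>D\<^sub>m\<^sup>2\<close>. On the axes both sides vanish,
since \<open>0 powr a = 0\<close> and \<open>inverse 0 = 0\<close>.\<close>

lemma dirac_coeff_bound:
  assumes "u \<ge> 0" "v \<ge> 0"
  shows "fact m * (dirac_coeff m x u v)\<^sup>2 * (u * v) ^ m \<le> 1 / sqrt (real m + 1) * inverse (u * v)"
proof (cases "u * v = 0")
  case True
  thus ?thesis by (simp only: dirac_coeff_def) simp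
next
  case False
  define s where "s = u * v"
  have s: "s > 0" using False assms by (simp add: s_def order.not_eq_order_implies_strict)
  define D where "D = gaussian_deriv m (x / sqrt s)"
  have p: "(s powr (- real m / 2))\<^sup>2 * s ^ m = 1"
  proof -
    have "(s powr (- real m / 2))\<^sup>2 = s powr (- real m)"
      using s by (simp add: power2_eq_square flip: powr_add)
    thus ?thesis using s by (simp add: powr_minus powr_realpow)
  qed
  have h: "heat_kernel s x * hermite m (x / sqrt s) = (-1) ^ m * D / (fact m * sqrt (2 * pi * s))"
  proof -
    have "exp (- x\<^sup>2 / (2 * s)) * exp ((x / sqrt s)\<^sup>2 / 2) = 1"
      using s by (simp add: power_divide flip: exp_add)
    thus ?thesis by (simp add: heat_kernel_def hermite_eq_gaussian_deriv D_def field_simps)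
  qed
  have "fact m * (dirac_coeff m x u v)\<^sup>2 * (u * v) ^ m =
      fact m * ((s powr (- real m / 2))\<^sup>2 * s ^ m) * (heat_kernel s x * hermite m (x / sqrt s))\<^sup>2"
    by (simp add: dirac_coeff_def flip: s_def) (simp add: power_mult_distrib)
  also have "\<dots> = D\<^sup>2 / fact m * (1 / (2 * pi * s))"
    unfolding p h using s by (simp add: power_divide power_mult_distrib power2_eq_square[of "fact m"]
      flip: power_mult)
  also have "\<dots> \<le> 1 / sqrt (real m + 1) * (1 / (1 * s))"
  proof (intro mult_mono)
    show "D\<^sup>2 / fact m \<le> 1 / sqrt (real m + 1)"
      using gaussian_deriv_bound[of m "x / sqrt s"] by (simp add: D_def field_simps)
    have "2 * pi \<ge> 1" using pi_ge_two by simp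
    thus "1 / (2 * pi * s) \<le> 1 / (1 * s)" using s
      by (intro divide_left_mono mult_right_mono) auto
  qed (use s in auto)
  finally show ?thesis by (simp add: s_def inverse_eq_divide)
qed

section \<open>Symmetrization of kernels with disjoint permuted copies\<close>

lemma card_permutes_agreeing_at_two:
  assumes p: "\<pi> permutes {..<m + 2}"
  shows "card {\<pi>'. \<pi>' permutes {..<m + 2} \<and> \<pi>' m = \<pi> m \<and> \<pi>' (m + 1) = \<pi> (m + 1)} = fact m"
proof -
  have "{\<pi>'. \<pi>' permutes {..<m + 2} \<and> \<pi>' m = \<pi> m \<and> \<pi>' (m + 1) = \<pi> (m + 1)} =
      (\<lambda>\<tau>. \<pi> \<circ> \<tau>) ` {\<tau>. \<tau> permutes {..<m}}"
  proof (intro equalityI subsetI; clarsimp)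
    fix q assume q: "q permutes {..<Suc (Suc m)}" "q m = \<pi> m" "q (Suc m) = \<pi> (Suc m)"
    have "inv \<pi> \<circ> q permutes {..<m + 2}"
      using q p by (simp add: permutes_compose permutes_inv)
    hence "inv \<pi> \<circ> q permutes {..<m}"
    proof (rule permutes_superset)
      fix i assume "i \<in> {..<m + 2} - {..<m}"
      hence "i = m \<or> i = Suc m" by auto
      thus "(inv \<pi> \<circ> q) i = i" using q p permutes_inverses(2)[OF p] by auto
    qed
    moreover have "q = \<pi> \<circ> (inv \<pi> \<circ> q)" using permutes_inverses(1)[OF p] by (auto simp: fun_eq_iff)
    ultimately show "q \<in> (\<lambda>\<tau>. \<pi> \<circ> \<tau>) ` {\<tau>. \<tau> permutes {..<m}}" by blast
  next
    fix t assume t: "t permutes {..<m}"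
    have "t permutes {..<m + 2}" by (rule permutes_subset[OF t]) auto
    thus "\<pi> \<circ> t permutes {..<Suc (Suc m)} \<and> \<pi> (t m) = \<pi> m \<and> \<pi> (t (Suc m)) = \<pi> (Suc m)"
      using p permutes_compose[of t "{..<m+2}" \<pi>] permutes_not_in[OF t, of m] permutes_not_in[OF t, of "Suc m"]
      by auto
  qed
  moreover have "inj_on (\<lambda>\<tau>. \<pi> \<circ> \<tau>) {\<tau>. \<tau> permutes {..<m}}"
    using permutes_inj[OF p] by (auto simp: inj_on_def fun_eq_iff dest: injD)
  ultimately show ?thesis by (simp add: card_image card_permutations)
qed

text \<open>In the square of the sum over permutations the mixed terms vanish unless the two permutations
agree on the last two places, and then the two factors are equal. Each permutation thus
contributes its own square once for each of the \<open>m!\<close> permutations agreeing with it.\<close>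

lemma symmetrization_square_of_orthogonal:
  assumes agree: "\<And>\<pi> \<pi>'. \<pi> permutes {..<m + 2} \<Longrightarrow> \<pi>' permutes {..<m + 2} \<Longrightarrow>
      \<pi>' m = \<pi> m \<Longrightarrow> \<pi>' (m + 1) = \<pi> (m + 1) \<Longrightarrow> f (w \<circ> \<pi>') = f (w \<circ> \<pi>)"
    and orth: "\<And>\<pi> \<pi>'. \<pi> permutes {..<m + 2} \<Longrightarrow> \<pi>' permutes {..<m + 2} \<Longrightarrow>
      f (w \<circ> \<pi>) \<noteq> 0 \<Longrightarrow> f (w \<circ> \<pi>') \<noteq> 0 \<Longrightarrow> \<pi>' m = \<pi> m \<and> \<pi>' (m + 1) = \<pi> (m + 1)"
  shows "(symmetrization (m + 2) f w)\<^sup>2 =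
      fact m / (fact (m + 2))\<^sup>2 * (\<Sum>\<pi> | \<pi> permutes {..<m + 2}. (f (w \<circ> \<pi>))\<^sup>2)"
proof -
  let ?P = "{\<pi>. \<pi> permutes {..<m + 2}}"
  let ?C = "\<lambda>\<pi>. {\<pi>'. \<pi>' permutes {..<m + 2} \<and> \<pi>' m = \<pi> m \<and> \<pi>' (m + 1) = \<pi> (m + 1)}"
  have fin: "finite ?P" by (rule finite_permutations) simp
  have "(\<Sum>\<pi>'\<in>?P. f (w \<circ> \<pi>) * f (w \<circ> \<pi>')) = fact m * (f (w \<circ> \<pi>))\<^sup>2" if p: "\<pi> \<in> ?P" for \<pi>
  proof -
    have "(\<Sum>\<pi>'\<in>?P. f (w \<circ> \<pi>) * f (w \<circ> \<pi>')) = (\<Sum>\<pi>'\<in>?C \<pi>. f (w \<circ> \<pi>) * f (w \<circ> \<pi>'))"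
    proof (rule sum.mono_neutral_right[OF fin])
      show "\<forall>\<pi>'\<in>?P - ?C \<pi>. f (w \<circ> \<pi>) * f (w \<circ> \<pi>') = 0"
      proof
        fix \<pi>' assume "\<pi>' \<in> ?P - ?C \<pi>"
        thus "f (w \<circ> \<pi>) * f (w \<circ> \<pi>') = 0" using orth[of \<pi> \<pi>'] p by auto
      qed
    qed auto
    also have "\<dots> = (\<Sum>\<pi>'\<in>?C \<pi>. (f (w \<circ> \<pi>))\<^sup>2)"
    proof (rule sum.cong[OF refl])
      fix \<pi>' assume "\<pi>' \<in> ?C \<pi>"
      thus "f (w \<circ> \<pi>) * f (w \<circ> \<pi>') = (f (w \<circ> \<pi>))\<^sup>2"
        using agree[of \<pi> \<pi>'] p by (simp add: power2_eq_square)
    qed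
    also have "\<dots> = fact m * (f (w \<circ> \<pi>))\<^sup>2"
      using p card_permutes_agreeing_at_two[of \<pi> m] by simp
    finally show ?thesis .
  qed
  hence "(\<Sum>\<pi>\<in>?P. \<Sum>\<pi>'\<in>?P. f (w \<circ> \<pi>) * f (w \<circ> \<pi>')) = (\<Sum>\<pi>\<in>?P. fact m * (f (w \<circ> \<pi>))\<^sup>2)"
    by (intro sum.cong refl)
  hence "(\<Sum>\<pi>\<in>?P. f (w \<circ> \<pi>))\<^sup>2 = fact m * (\<Sum>\<pi>\<in>?P. (f (w \<circ> \<pi>))\<^sup>2)"
    by (simp only: power2_eq_square[of "sum _ _"] sum_product flip: sum_distrib_left)
  thus ?thesis by (simp add: symmetrization_def power_divide)
qed

lemma symmetrization_permute:
  assumes s: "\<sigma> permutes {..<n}"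
  shows "symmetrization n f (w \<circ> \<sigma>) = symmetrization n f w"
proof -
  have "(\<Sum>\<pi> | \<pi> permutes {..<n}. f (w \<circ> \<sigma> \<circ> \<pi>)) = (\<Sum>\<pi> | \<pi> permutes {..<n}. f (w \<circ> \<pi>))"
    by (subst (2) setum_permutations_compose_left[OF s]) (simp add: o_assoc)
  thus ?thesis by (simp add: symmetrization_def)
qed

section \<open>Product measures over the unit square\<close>

lemma space_unit_square [simp]: "space unit_square = {0..1} \<times> {0..1}"
  by (simp add: unit_square_def space_restrict_space)

lemma fst_unit_square [measurable]: "fst \<in> borel_measurable unit_square"
  and snd_unit_square [measurable]: "snd \<in> borel_measurable unit_square"
  unfolding unit_square_def
  by (auto intro!: measurable_restrict_space1 borel_measurable_continuous_onI continuous_intros)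

lemma nn_integral_unit_square:
  fixes f :: "real \<times> real \<Rightarrow> ennreal"
  assumes "f \<in> borel_measurable borel"
  shows "(\<integral>\<^sup>+z. f z \<partial>unit_square) =
    (\<integral>\<^sup>+u. \<integral>\<^sup>+v. f (u, v) * (indicator {0..1} u * indicator {0..1} v) \<partial>lborel \<partial>lborel)"
proof -
  have c: "{0..1::real} \<times> {0..1::real} \<in> sets borel" by (intro borel_closed closed_Times) auto
  have "(\<integral>\<^sup>+z. f z \<partial>unit_square) = (\<integral>\<^sup>+z. f z * indicator ({0..1} \<times> {0..1}) z \<partial>lborel)"
    unfolding unit_square_def by (rule nn_integral_restrict_space) (use c in simp)
  also have "\<dots> = (\<integral>\<^sup>+z. f z * indicator ({0..1} \<times> {0..1}) z \<partial>(lborel \<Otimes>\<^sub>M lborel))"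
    by (simp only: lborel_prod)
  also have "\<dots> = (\<integral>\<^sup>+u. \<integral>\<^sup>+v. f (u, v) * indicator ({0..1} \<times> {0..1}) (u, v) \<partial>lborel \<partial>lborel)"
    using assms c by (intro lborel.nn_integral_fst[symmetric]) (simp add: lborel_prod)
  finally show ?thesis by (simp add: indicator_times)
qed

lemma nn_integral_unit_square_rectangle:
  assumes "u \<in> {0..1}" "v \<in> {0..1}"
  shows "(\<integral>\<^sup>+z. indicator ({0..u} \<times> {0..v}) z \<partial>unit_square) = ennreal (u * v)"
proof -
  have c: "{0..u} \<times> {0..v} \<in> sets borel" by (intro borel_closed closed_Times) auto
  have "(\<integral>\<^sup>+z. indicator ({0..u} \<times> {0..v}) z \<partial>unit_square) =
      (\<integral>\<^sup>+s. \<integral>\<^sup>+t. indicator ({0..u} \<times> {0..v}) (s, t) * (indicator {0..1} s * indicator {0..1} t)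
        \<partial>lborel \<partial>lborel)"
    using c by (intro nn_integral_unit_square) simp
  also have "\<dots> = (\<integral>\<^sup>+s. \<integral>\<^sup>+t. indicator {0..u} s * indicator {0..v} t \<partial>lborel \<partial>lborel)"
    using assms by (intro nn_integral_cong) (auto simp: indicator_def)
  also have "\<dots> = ennreal u * ennreal v"
    using assms by (simp add: nn_integral_cmult nn_integral_multc)
  finally show ?thesis using assms by (simp add: ennreal_mult)
qed

lemma prob_space_unit_square: "prob_space unit_square"
proof
  have "(\<integral>\<^sup>+z. indicator ({0..1} \<times> {0..1}) z \<partial>unit_square) = emeasure unit_square (space unit_square)"
    unfolding space_unit_square by (rule nn_integral_indicator) (use sets.top[of unit_square] in simp)
  thus "emeasure unit_square (space unit_square) = 1"
    using nn_integral_unit_square_rectangle[of 1 1] by simp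
qed

interpretation unit_square: product_sigma_finite "\<lambda>_. unit_square"
  by (simp add: product_sigma_finite_def prob_space_unit_square prob_space_imp_sigma_finite)

lemma coordinates_measurable [measurable (raw)]:
  assumes "i \<in> I"
  shows "(\<lambda>w. fst (w i)) \<in> borel_measurable (PiM I (\<lambda>_. unit_square))"
    and "(\<lambda>w. snd (w i)) \<in> borel_measurable (PiM I (\<lambda>_. unit_square))"
  using assms by measurable

lemma AE_unit_square_coordinates_differ:
  "AE z in unit_square. fst z \<noteq> c" "AE z in unit_square. snd z \<noteq> c"
proof -
  have m: "{z :: real \<times> real. fst z = c} \<in> sets borel" "{z :: real \<times> real. snd z = c} \<in> sets borel"
    by (auto intro!: borel_closed closed_Collect_eq continuous_intros)
  have "(\<integral>\<^sup>+z. indicator {z. fst z = c} z \<partial>unit_square) =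
      (\<integral>\<^sup>+u. \<integral>\<^sup>+(v::real). indicator {c} u * (indicator {0..1} u * indicator {0..1} v) \<partial>lborel \<partial>lborel)"
    using m by (subst nn_integral_unit_square) (auto simp: indicator_def intro!: nn_integral_cong)
  also have "\<dots> = (\<integral>\<^sup>+u. indicator {c} u * indicator {0..1} u \<partial>(lborel :: real measure))"
    by (simp add: nn_integral_cmult flip: mult.assoc)
  also have "\<dots> = 0"
    by (subst nn_integral_0_iff_AE) (auto intro: AE_mp[OF AE_lborel_singleton[of c]] simp: indicator_def)
  finally have 1: "(\<integral>\<^sup>+z. indicator {z. fst z = c} z \<partial>unit_square) = 0" .
  have "(\<integral>\<^sup>+z. indicator {z. snd z = c} z \<partial>unit_square) =
      (\<integral>\<^sup>+(u::real). \<integral>\<^sup>+v. indicator {c} v * (indicator {0..1} u * indicator {0..1} v) \<partial>lborel \<partial>lborel)"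
    using m by (subst nn_integral_unit_square) (auto simp: indicator_def intro!: nn_integral_cong)
  also have "\<dots> = (\<integral>\<^sup>+u. 0 \<partial>(lborel :: real measure))"
    by (intro nn_integral_cong, subst nn_integral_0_iff_AE)
       (auto intro: AE_mp[OF AE_lborel_singleton[of c]] simp: indicator_def)
  finally have 2: "(\<integral>\<^sup>+z. indicator {z. snd z = c} z \<partial>unit_square) = 0" by simp
  have [measurable]: "(\<lambda>z. indicator {z. fst z = c} z :: ennreal) \<in> borel_measurable unit_square"
     "(\<lambda>z. indicator {z. snd z = c} z :: ennreal) \<in> borel_measurable unit_square"
    using m unfolding unit_square_def by (auto intro!: measurable_restrict_space1)
  show "AE z in unit_square. fst z \<noteq> c"
    using 1 by (subst (asm) nn_integral_0_iff_AE) auto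
  show "AE z in unit_square. snd z \<noteq> c"
    using 2 by (subst (asm) nn_integral_0_iff_AE) auto
qed

lemma AE_kernel_measure_component_differs:
  fixes h :: "real \<times> real \<Rightarrow> real"
  assumes ij: "i < n" "j < n" "i \<noteq> j"
    and [measurable]: "h \<in> borel_measurable unit_square"
    and h: "\<And>c. AE z in unit_square. h z \<noteq> c"
  shows "AE w in kernel_measure n. h (w i) \<noteq> h (w j)"
proof -
  let ?I = "{..<n} - {i}"
  have ins: "insert i ?I = {..<n}" using ij by auto
  have j: "j \<in> ?I" using ij by auto
  have "(\<lambda>w. h (w k)) \<in> borel_measurable (PiM {..<n} (\<lambda>_. unit_square))" if "k < n" for k
    using that by (intro measurable_compose[OF measurable_component_singleton]) auto
  from this[OF ij(1)] this[OF ij(2)]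
  have [measurable]: "Measurable.pred (PiM {..<n} (\<lambda>_. unit_square)) (\<lambda>w. h (w i) = h (w j))"
    unfolding pred_def by (rule borel_measurable_eq)
  have [measurable]: "(\<lambda>w. indicator {w. h (w i) = h (w j)} w :: ennreal)
      \<in> borel_measurable (PiM {..<n} (\<lambda>_. unit_square))"
    unfolding indicator_def mem_Collect_eq by measurable
  have "(\<integral>\<^sup>+w. indicator {w. h (w i) = h (w j)} w \<partial>kernel_measure n) =
      (\<integral>\<^sup>+w. \<integral>\<^sup>+z. indicator {w. h (w i) = h (w j)} (w(i := z)) \<partial>unit_square \<partial>PiM ?I (\<lambda>_. unit_square))"
    unfolding kernel_measure_def
    by (subst ins[symmetric], rule unit_square.product_nn_integral_insert)
       (simp_all add: ij insert_absorb)
  also have "\<dots> = (\<integral>\<^sup>+w. 0 \<partial>PiM ?I (\<lambda>_. unit_square))"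
  proof (rule nn_integral_cong)
    fix w
    have "(\<integral>\<^sup>+z. indicator {w. h (w i) = h (w j)} (w(i := z)) \<partial>unit_square) =
        (\<integral>\<^sup>+z. indicator {z. h z = h (w j)} z \<partial>unit_square)"
      using ij by (intro nn_integral_cong) (auto simp: indicator_def)
    also have "\<dots> = 0"
    proof (subst nn_integral_0_iff_AE)
      show "(\<lambda>z. indicator {z. h z = h (w j)} z :: ennreal) \<in> borel_measurable unit_square"
        unfolding indicator_def mem_Collect_eq by measurable
      show "AE z in unit_square. indicator {z. h z = h (w j)} z = (0::ennreal)"
        using h[of "h (w j)"] by eventually_elim simp
    qed
    finally show "(\<integral>\<^sup>+z. indicator {w. h (w i) = h (w j)} (w(i := z)) \<partial>unit_square) = 0" .
  qed
  finally have "(\<integral>\<^sup>+w. indicator {w. h (w i) = h (w j)} w \<partial>kernel_measure n) = 0" by simp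
  thus ?thesis
    unfolding kernel_measure_def by (subst (asm) nn_integral_0_iff_AE) auto
qed

text \<open>This is what makes the maximum of either coordinate sit at a single point.\<close>

lemma AE_kernel_measure_distinct_coordinates:
  "AE w in kernel_measure n. inj_on (\<lambda>i. fst (w i)) {..<n} \<and> inj_on (\<lambda>i. snd (w i)) {..<n}"
proof -
  have "AE w in kernel_measure n. i \<noteq> j \<longrightarrow> fst (w i) \<noteq> fst (w j) \<and> snd (w i) \<noteq> snd (w j)"
    if "i < n" "j < n" for i j
    using AE_kernel_measure_component_differs[OF that _ fst_unit_square AE_unit_square_coordinates_differ(1)]
      AE_kernel_measure_component_differs[OF that _ snd_unit_square AE_unit_square_coordinates_differ(2)]
    by (cases "i = j") auto
  hence "AE w in kernel_measure n. \<forall>i\<in>{..<n}. \<forall>j\<in>{..<n}. 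
      i \<noteq> j \<longrightarrow> fst (w i) \<noteq> fst (w j) \<and> snd (w i) \<noteq> snd (w j)"
    by (intro AE_finite_allI) auto
  thus ?thesis by eventually_elim (auto simp: inj_on_def)
qed

text \<open>Points of a product space take the value \<open>undefined\<close> outside the index set, which a
permutation of the index set fixes; so composition agrees with the restricted reindexing for which
invariance of the product measure is known.\<close>

lemma kernel_permute_eq:
  assumes "\<pi> permutes {..<n}" "w \<in> space (kernel_measure n)"
  shows "(\<lambda>i\<in>{..<n}. w (\<pi> i)) = w \<circ> \<pi>"
proof
  fix i
  show "(\<lambda>i\<in>{..<n}. w (\<pi> i)) i = (w \<circ> \<pi>) i"
    using assms permutes_not_in[OF assms(1), of i]
    by (cases "i < n") (auto simp: kernel_measure_def space_PiM PiE_def extensional_def)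
qed

lemma distr_kernel_measure_permute:
  assumes p: "\<pi> permutes {..<n}"
  shows "distr (kernel_measure n) (kernel_measure n) (\<lambda>w. w \<circ> \<pi>) = kernel_measure n"
proof -
  have "distr (kernel_measure n) (kernel_measure n) (\<lambda>w. w \<circ> \<pi>) =
      distr (kernel_measure n) (kernel_measure n) (\<lambda>w. \<lambda>i\<in>{..<n}. w (\<pi> i))"
    by (rule distr_cong) (simp_all add: kernel_permute_eq[OF p])
  also have "\<dots> = kernel_measure n"
    unfolding kernel_measure_def
    by (rule distr_PiM_reindex)
       (use permutes_in_image[OF p] in
         \<open>auto simp: prob_space_unit_square permutes_inj_on[OF p]\<close>)
  finally show ?thesis .
qed

lemma permute_measurable:
  assumes p: "\<pi> permutes {..<n}"
  shows "(\<lambda>w. w \<circ> \<pi>) \<in> measurable (kernel_measure n) (kernel_measure n)"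
proof -
  have "(\<lambda>w. \<lambda>i\<in>{..<n}. w (\<pi> i)) \<in> measurable (kernel_measure n) (kernel_measure n)"
    unfolding kernel_measure_def
    by (intro measurable_restrict measurable_component_singleton)
       (simp only: permutes_in_image[OF p])
  thus ?thesis
    by (rule measurable_cong[THEN iffD1, rotated]) (simp add: kernel_permute_eq[OF p])
qed

lemma nn_integral_kernel_measure_permute:
  assumes p: "\<pi> permutes {..<n}" and f: "f \<in> borel_measurable (kernel_measure n)"
  shows "(\<integral>\<^sup>+w. f (w \<circ> \<pi>) \<partial>kernel_measure n) = (\<integral>\<^sup>+w. f w \<partial>kernel_measure n)"
  using nn_integral_distr[OF permute_measurable[OF p], of f] f
  by (simp add: distr_kernel_measure_permute[OF p])

lemma symmetrization_measurable:
  assumes "f \<in> borel_measurable (kernel_measure n)"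
  shows "symmetrization n f \<in> borel_measurable (kernel_measure n)"
proof -
  have "(\<lambda>w. f (w \<circ> \<pi>)) \<in> borel_measurable (kernel_measure n)" if "\<pi> permutes {..<n}" for \<pi>
    by (rule measurable_compose[OF permute_measurable[OF that] assms])
  thus ?thesis unfolding symmetrization_def by (intro borel_measurable_divide borel_measurable_sum) auto
qed

text \<open>The pointwise identity for the square of the symmetrization is integrated; by invariance of the
product measure all \<open>(m + 2)!\<close> terms have the same integral.\<close>

lemma nn_integral_symmetrization_square:
  assumes f [measurable]: "f \<in> borel_measurable (kernel_measure (m + 2))"
    and agree: "\<And>w \<pi> \<pi>'. \<pi> permutes {..<m + 2} \<Longrightarrow> \<pi>' permutes {..<m + 2} \<Longrightarrow>
      \<pi>' m = \<pi> m \<Longrightarrow> \<pi>' (m + 1) = \<pi> (m + 1) \<Longrightarrow> f (w \<circ> \<pi>') = f (w \<circ> \<pi>)"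
    and orth: "AE w in kernel_measure (m + 2). \<forall>\<pi> \<pi>'. \<pi> permutes {..<m + 2} \<longrightarrow> \<pi>' permutes {..<m + 2} \<longrightarrow>
      f (w \<circ> \<pi>) \<noteq> 0 \<longrightarrow> f (w \<circ> \<pi>') \<noteq> 0 \<longrightarrow> \<pi>' m = \<pi> m \<and> \<pi>' (m + 1) = \<pi> (m + 1)"
  shows "(\<integral>\<^sup>+w. ennreal ((symmetrization (m + 2) f w)\<^sup>2) \<partial>kernel_measure (m + 2)) =
      ennreal (fact m / fact (m + 2)) * (\<integral>\<^sup>+w. ennreal ((f w)\<^sup>2) \<partial>kernel_measure (m + 2))"
proof -
  let ?K = "kernel_measure (m + 2)" and ?P = "{\<pi>. \<pi> permutes {..<m + 2}}"
  let ?c = "fact m / (fact (m + 2))\<^sup>2 :: real"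
  have meas: "(\<lambda>w. ennreal ((f (w \<circ> \<pi>))\<^sup>2)) \<in> borel_measurable ?K" if "\<pi> \<in> ?P" for \<pi>
    using measurable_compose[OF permute_measurable f, of \<pi>] that by simp
  have "(\<integral>\<^sup>+w. ennreal ((symmetrization (m + 2) f w)\<^sup>2) \<partial>?K) =
      (\<integral>\<^sup>+w. ennreal ?c * (\<Sum>\<pi>\<in>?P. ennreal ((f (w \<circ> \<pi>))\<^sup>2)) \<partial>?K)"
  proof (rule nn_integral_cong_AE, use orth in eventually_elim)
    fix w assume *: "\<forall>\<pi> \<pi>'. \<pi> permutes {..<m + 2} \<longrightarrow> \<pi>' permutes {..<m + 2} \<longrightarrow>
      f (w \<circ> \<pi>) \<noteq> 0 \<longrightarrow> f (w \<circ> \<pi>') \<noteq> 0 \<longrightarrow> \<pi>' m = \<pi> m \<and> \<pi>' (m + 1) = \<pi> (m + 1)"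
    have "(symmetrization (m + 2) f w)\<^sup>2 = ?c * (\<Sum>\<pi>\<in>?P. (f (w \<circ> \<pi>))\<^sup>2)"
      by (rule symmetrization_square_of_orthogonal) (use agree * in blast)+
    moreover have "(\<Sum>\<pi>\<in>?P. ennreal ((f (w \<circ> \<pi>))\<^sup>2)) = ennreal (\<Sum>\<pi>\<in>?P. (f (w \<circ> \<pi>))\<^sup>2)"
      by (rule sum_ennreal) simp
    ultimately show "ennreal ((symmetrization (m + 2) f w)\<^sup>2) =
        ennreal ?c * (\<Sum>\<pi>\<in>?P. ennreal ((f (w \<circ> \<pi>))\<^sup>2))"
      by (simp only:) (rule ennreal_mult', simp)
  qed
  also have "\<dots> = ennreal ?c * (\<integral>\<^sup>+w. (\<Sum>\<pi>\<in>?P. ennreal ((f (w \<circ> \<pi>))\<^sup>2)) \<partial>?K)"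
    by (rule nn_integral_cmult) (intro borel_measurable_sum meas)
  also have "(\<integral>\<^sup>+w. (\<Sum>\<pi>\<in>?P. ennreal ((f (w \<circ> \<pi>))\<^sup>2)) \<partial>?K) =
      (\<Sum>\<pi>\<in>?P. \<integral>\<^sup>+w. ennreal ((f (w \<circ> \<pi>))\<^sup>2) \<partial>?K)"
    by (rule nn_integral_sum) (rule meas)
  also have "\<dots> = (\<Sum>\<pi>\<in>?P. \<integral>\<^sup>+w. ennreal ((f w)\<^sup>2) \<partial>?K)"
    by (intro sum.cong refl
        nn_integral_kernel_measure_permute[where f = "\<lambda>w. ennreal ((f w)\<^sup>2)"])
       (simp_all del: add_2_eq_Suc')
  also have "\<dots> = ennreal (fact (m + 2)) * (\<integral>\<^sup>+w. ennreal ((f w)\<^sup>2) \<partial>?K)"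
  proof -
    have "of_nat (card ?P) = ennreal (fact (m + 2))"
      by (simp only: card_permutations[OF refl finite_lessThan] card_lessThan
          ennreal_of_nat_eq_real_of_nat of_nat_fact)
    thus ?thesis by (simp only: sum_constant)
  qed
  finally have "(\<integral>\<^sup>+w. ennreal ((symmetrization (m + 2) f w)\<^sup>2) \<partial>?K) =
      ennreal ?c * ennreal (fact (m + 2)) * (\<integral>\<^sup>+w. ennreal ((f w)\<^sup>2) \<partial>?K)"
    by (simp only: mult.assoc)
  also have "ennreal ?c * ennreal (fact (m + 2)) = ennreal (fact m / fact (m + 2))"
    by (subst ennreal_mult[symmetric]) (auto simp: power2_eq_square simp del: fact_Suc)
  finally show ?thesis .
qed

section \<open>The kernels of the current\<close>

text \<open>The kernel of order \<open>m + 2\<close> before symmetrization.\<close>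

definition current_kernel :: "real \<Rightarrow> nat \<Rightarrow> kernel" where
  "current_kernel x m w = current_integrand x (w m) (w (m + 1)) m (restrict w {..<m})"

lemma double_skorohod_current:
  "double_skorohod (current_integrand x) (Suc (Suc m)) = symmetrization (m + 2) (current_kernel x m)"
  by (simp add: current_kernel_def[abs_def])

lemma current_kernel_eq:
  "current_kernel x m w = dirac_coeff m x (fst (w m)) (snd (w (m + 1))) *
     (\<Prod>i<m. indicator ({0..fst (w m)} \<times> {0..snd (w (m + 1))}) (w i)) *
     indicator {0..fst (w m)} (fst (w (m + 1))) * indicator {0..snd (w (m + 1))} (snd (w m))"
  by (simp add: current_kernel_def current_integrand_def dirac_expansion_def case_prod_unfold)

lemma current_kernel_nonzero_imp_max:
  assumes nz: "current_kernel x m w \<noteq> 0" and i: "i < m + 2"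
  shows "fst (w i) \<le> fst (w m)" "snd (w i) \<le> snd (w (m + 1))"
proof -
  have *: "w i \<in> {0..fst (w m)} \<times> {0..snd (w (m + 1))}" if "i < m"
    using nz that unfolding current_kernel_eq by (auto simp: indicator_def split: if_splits)
  have "fst (w (m + 1)) \<in> {0..fst (w m)}" "snd (w m) \<in> {0..snd (w (m + 1))}"
    using nz unfolding current_kernel_eq by (auto simp: indicator_def split: if_splits)
  moreover have "i < m \<or> i = m \<or> i = m + 1" using i by auto
  ultimately show "fst (w i) \<le> fst (w m)" "snd (w i) \<le> snd (w (m + 1))"
    using * by (auto simp: mem_Times_iff)
qed

text \<open>Apart from the points at the last two places, the kernel sees only the set of the remaining ones,
through a product over all of them.\<close>

lemma current_kernel_permute_agree:
  assumes p: "\<pi> permutes {..<m + 2}" "\<pi>' permutes {..<m + 2}"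
    and e: "\<pi>' m = \<pi> m" "\<pi>' (m + 1) = \<pi> (m + 1)"
  shows "current_kernel x m (w \<circ> \<pi>') = current_kernel x m (w \<circ> \<pi>)"
proof -
  have prod: "(\<Prod>i<m. h ((w \<circ> \<rho>) i)) = (\<Prod>k\<in>{..<m + 2} - {\<rho> m, \<rho> (m + 1)}. h (w k))"
    if r: "\<rho> permutes {..<m + 2}" for \<rho> and h :: "real \<times> real \<Rightarrow> real"
  proof -
    have "{..<m} = {..<m + 2} - {m, m + 1}" by auto
    hence "\<rho> ` {..<m} = {..<m + 2} - {\<rho> m, \<rho> (m + 1)}"
      using permutes_image[OF r] by (simp add: image_set_diff[OF permutes_inj[OF r]])
    thus ?thesis
      using prod.reindex[OF permutes_inj_on[OF r], of "\<lambda>k. h (w k)" "{..<m}"] by (simp add: comp_def)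
  qed
  show ?thesis
    unfolding current_kernel_eq prod[OF p(1)] prod[OF p(2)] using e by simp
qed

text \<open>If two permuted copies are nonzero at \<open>w\<close>, the points they put at place \<open>m\<close> both have maximal
first coordinate and those at place \<open>m + 1\<close> both have maximal second coordinate, hence they are
equal once the coordinates are distinct.\<close>

lemma current_kernel_orthogonal:
  "AE w in kernel_measure (m + 2). \<forall>\<pi> \<pi>'. \<pi> permutes {..<m + 2} \<longrightarrow> \<pi>' permutes {..<m + 2} \<longrightarrow>
      current_kernel x m (w \<circ> \<pi>) \<noteq> 0 \<longrightarrow> current_kernel x m (w \<circ> \<pi>') \<noteq> 0 \<longrightarrow>
      \<pi>' m = \<pi> m \<and> \<pi>' (m + 1) = \<pi> (m + 1)"
  using AE_kernel_measure_distinct_coordinates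
proof eventually_elim
  case (elim w)
  have le: "fst (w k) \<le> fst (w (\<pi> m)) \<and> snd (w k) \<le> snd (w (\<pi> (m + 1)))"
    if p: "\<pi> permutes {..<m + 2}" and nz: "current_kernel x m (w \<circ> \<pi>) \<noteq> 0" and k: "k < m + 2" for \<pi> k
  proof -
    have "inv \<pi> k < m + 2" using permutes_in_image[OF permutes_inv[OF p], of k] k by simp
    thus ?thesis
      using current_kernel_nonzero_imp_max[OF nz, of "inv \<pi> k"] permutes_inverses(1)[OF p] by simp
  qed
  have lt: "\<pi> m < m + 2" "\<pi> (m + 1) < m + 2" if "\<pi> permutes {..<m + 2}" for \<pi>
    using permutes_in_image[OF that, of m] permutes_in_image[OF that, of "m + 1"] by auto
  show ?case
  proof (intro allI impI)
    fix \<pi> \<pi>' assume *: "\<pi> permutes {..<m + 2}" "\<pi>' permutes {..<m + 2}"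
      "current_kernel x m (w \<circ> \<pi>) \<noteq> 0" "current_kernel x m (w \<circ> \<pi>') \<noteq> 0"
    have "fst (w (\<pi>' m)) = fst (w (\<pi> m))" "snd (w (\<pi>' (m + 1))) = snd (w (\<pi> (m + 1)))"
      using le[OF *(1,3)] le[OF *(2,4)] lt[OF *(1)] lt[OF *(2)] by (meson order_antisym)+
    thus "\<pi>' m = \<pi> m \<and> \<pi>' (m + 1) = \<pi> (m + 1)"
      using elim lt[OF *(1)] lt[OF *(2)] by (auto dest: inj_onD)
  qed
qed

lemma current_kernel_measurable:
  "current_kernel x m \<in> borel_measurable (kernel_measure (m + 2))"
proof -
  let ?P = "PiM {..<m + 2} (\<lambda>_::nat. unit_square)"
  have ind: "indicator ({0..u} \<times> {0..v}) z = indicator {0..u} (fst z) * (indicator {0..v} (snd z) :: real)"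
    for u v :: real and z
    by (cases z) (auto simp: indicator_def)
  have ind1: "indicator {0..u} t = (if 0 \<le> t \<and> t \<le> u then 1 else 0 :: real)" for u t :: real
    by (auto simp: indicator_def)
  have seg: "(\<lambda>w. indicator {0..c w} (a w) :: real) \<in> borel_measurable ?P"
    if "a \<in> borel_measurable ?P" "c \<in> borel_measurable ?P"
    for a c :: "(nat \<Rightarrow> real \<times> real) \<Rightarrow> real"
    unfolding ind1
    by (intro measurable_If sets.sets_Collect_conj borel_measurable_le borel_measurable_const that)
  show ?thesis
    unfolding current_kernel_eq[abs_def] kernel_measure_def ind
    by (intro borel_measurable_times borel_measurable_prod dirac_coeff_measurable seg
        coordinates_measurable) auto
qed

lemma nn_integral_triangle_inverse:
  "(\<integral>\<^sup>+s. \<integral>\<^sup>+u. ennreal (inverse u) * (indicator {0..u} s * indicator {0..1} u) \<partial>lborel \<partial>lborel) \<le> 1"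
proof -
  have ind: "indicator {0..u} s = (if 0 \<le> s \<and> s \<le> u then 1 else 0 :: ennreal)" for u s :: real
    by (auto simp: indicator_def)
  have "(\<integral>\<^sup>+s. \<integral>\<^sup>+u. ennreal (inverse u) * (indicator {0..u} s * indicator {0..1} u) \<partial>lborel \<partial>lborel) =
      (\<integral>\<^sup>+u. \<integral>\<^sup>+s. ennreal (inverse u) * (indicator {0..u} s * indicator {0..1} u) \<partial>lborel \<partial>lborel)"
    by (rule lborel_pair.Fubini') (simp add: ind, measurable)
  also have "\<dots> = (\<integral>\<^sup>+u. ennreal (inverse u) * indicator {0..1} u * emeasure lborel {0..u} \<partial>lborel)"
    by (intro nn_integral_cong, subst nn_integral_cmult_indicator[symmetric])
       (auto simp: mult_ac intro!: nn_integral_cong)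
  also have "\<dots> \<le> (\<integral>\<^sup>+u. indicator {0..1::real} u \<partial>lborel)"
  proof (rule nn_integral_mono)
    fix u :: real
    show "ennreal (inverse u) * indicator {0..1} u * emeasure lborel {0..u} \<le> indicator {0..1} u"
      by (cases "u = 0") (auto simp: indicator_def simp flip: ennreal_mult')
  qed
  also have "\<dots> = 1" by simp
  finally show ?thesis .
qed

text \<open>The integrand splits into a function of the two first coordinates and the same function of the two
second coordinates in the opposite order, so the integral is the square of the one over the
triangle. The constant \<open>c\<close> is carried along so that it can be pulled out after the splitting.\<close>

lemma nn_integral_maximal_points:
  "(\<integral>\<^sup>+z2. \<integral>\<^sup>+z1. c * (ennreal (inverse (fst z1 * snd z2)) *
      (indicator {0..fst z1} (fst z2) * indicator {0..snd z2} (snd z1))) \<partial>unit_square \<partial>unit_square) \<le> c"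
proof -
  define g :: "real \<Rightarrow> real \<Rightarrow> ennreal"
    where "g u s = ennreal (inverse u) * (indicator {0..u} s * indicator {0..1} u)" for u s
  have g [measurable]: "(\<lambda>z. g (a z) (b z)) \<in> borel_measurable N"
    if [measurable]: "a \<in> borel_measurable N" "b \<in> borel_measurable N" for a b and N :: "'b measure"
  proof -
    have ind: "indicator {0..u} s = (if 0 \<le> s \<and> s \<le> u then 1 else 0 :: ennreal)" for u s :: real
      by (auto simp: indicator_def)
    show ?thesis unfolding g_def ind by measurable
  qed
  have [measurable]: "fst \<in> borel_measurable (borel :: (real \<times> real) measure)"
     "snd \<in> borel_measurable (borel :: (real \<times> real) measure)"
    by (auto intro!: borel_measurable_continuous_onI continuous_intros)
  have split: "ennreal (inverse (fst z1 * snd z2)) *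
      (indicator {0..fst z1} (fst z2) * indicator {0..snd z2} (snd z1)) = g (fst z1) (fst z2) * g (snd z2) (snd z1)"
    if "z1 \<in> space unit_square" "z2 \<in> space unit_square" for z1 z2
    using that by (auto simp: g_def indicator_def simp flip: ennreal_mult')
  have inner: "(\<integral>\<^sup>+z1. c * (g (fst z1) s * g v (snd z1)) \<partial>unit_square) \<le> c * (\<integral>\<^sup>+u. g u s \<partial>lborel) * (\<integral>\<^sup>+t. g v t \<partial>lborel)" for s v
  proof -
    have "(\<integral>\<^sup>+z1. c * (g (fst z1) s * g v (snd z1)) \<partial>unit_square) =
       (\<integral>\<^sup>+u. \<integral>\<^sup>+t. c * (g u s * g v t) * (indicator {0..1} u * indicator {0..1} t) \<partial>lborel \<partial>lborel)"
      by (subst nn_integral_unit_square) auto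
    also have "\<dots> \<le> (\<integral>\<^sup>+u. \<integral>\<^sup>+t. c * g u s * g v t \<partial>lborel \<partial>lborel)"
      by (intro nn_integral_mono) (auto simp: indicator_def mult.assoc)
    also have "\<dots> = c * (\<integral>\<^sup>+u. g u s \<partial>lborel) * (\<integral>\<^sup>+t. g v t \<partial>lborel)"
      by (simp add: nn_integral_cmult nn_integral_multc)
    finally show ?thesis .
  qed
  let ?G = "\<integral>\<^sup>+s. \<integral>\<^sup>+u. g u s \<partial>lborel \<partial>lborel"
  have G: "?G \<le> 1" unfolding g_def by (rule nn_integral_triangle_inverse)
  have "(\<integral>\<^sup>+z2. \<integral>\<^sup>+z1. c * (ennreal (inverse (fst z1 * snd z2)) *
      (indicator {0..fst z1} (fst z2) * indicator {0..snd z2} (snd z1))) \<partial>unit_square \<partial>unit_square) =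
     (\<integral>\<^sup>+z2. \<integral>\<^sup>+z1. c * (g (fst z1) (fst z2) * g (snd z2) (snd z1)) \<partial>unit_square \<partial>unit_square)"
    by (intro nn_integral_cong) (simp only: split)
  also have "\<dots> \<le> (\<integral>\<^sup>+z2. c * (\<integral>\<^sup>+u. g u (fst z2) \<partial>lborel) * (\<integral>\<^sup>+t. g (snd z2) t \<partial>lborel) \<partial>unit_square)"
    by (intro nn_integral_mono inner)
  also have "\<dots> = (\<integral>\<^sup>+s. \<integral>\<^sup>+v. c * (\<integral>\<^sup>+u. g u s \<partial>lborel) * (\<integral>\<^sup>+t. g v t \<partial>lborel) *
      (indicator {0..1} s * indicator {0..1} v) \<partial>lborel \<partial>lborel)"
    by (subst nn_integral_unit_square) auto
  also have "\<dots> \<le> (\<integral>\<^sup>+s. \<integral>\<^sup>+v. c * (\<integral>\<^sup>+u. g u s \<partial>lborel) * (\<integral>\<^sup>+t. g v t \<partial>lborel) \<partial>lborel \<partial>lborel)"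
    by (intro nn_integral_mono) (auto simp: indicator_def)
  also have "\<dots> = c * ?G * (\<integral>\<^sup>+v. \<integral>\<^sup>+t. g v t \<partial>lborel \<partial>lborel)"
    by (simp add: nn_integral_cmult nn_integral_multc)
  also have "(\<integral>\<^sup>+v. \<integral>\<^sup>+t. g v t \<partial>lborel \<partial>lborel) = ?G"
    by (rule lborel_pair.Fubini'[symmetric]) measurable
  also have "c * ?G * ?G \<le> c * 1 * 1" using G by (intro mult_mono) auto
  finally show ?thesis by simp
qed

text \<open>For fixed last two points, the free points range independently over the rectangle
\<open>{0..fst z1} \<times> {0..snd z2}\<close>.\<close>

lemma nn_integral_current_kernel_inner:
  assumes z: "z1 \<in> {0..1} \<times> {0..1}" "z2 \<in> {0..1} \<times> {0..1}"
  shows "(\<integral>\<^sup>+w. ennreal (fact m * (current_kernel x m (w(m := z1, m + 1 := z2)))\<^sup>2)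
            \<partial>PiM {..<m} (\<lambda>_. unit_square))
     \<le> ennreal (1 / sqrt (real m + 1)) * (ennreal (inverse (fst z1 * snd z2)) *
          (indicator {0..fst z1} (fst z2) * indicator {0..snd z2} (snd z1)))"
proof -
  let ?u = "fst z1" and ?v = "snd z2"
  let ?R = "{0..?u} \<times> {0..?v}"
  let ?I = "indicator {0..?u} (fst z2) * indicator {0..?v} (snd z1)"
  have uv: "?u \<in> {0..1}" "?v \<in> {0..1}" using z by auto
  have R: "?R \<in> sets borel" by (intro borel_closed closed_Times) auto
  have Rm [measurable]: "(indicator ?R :: _ \<Rightarrow> ennreal) \<in> borel_measurable unit_square"
    unfolding unit_square_def using R by (intro measurable_restrict_space1) simp
  have "(\<integral>\<^sup>+w. ennreal (fact m * (current_kernel x m (w(m := z1, m + 1 := z2)))\<^sup>2)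
            \<partial>PiM {..<m} (\<lambda>_. unit_square)) =
      (\<integral>\<^sup>+w. ennreal (fact m * (dirac_coeff m x ?u ?v)\<^sup>2) * ?I * (\<Prod>i<m. indicator ?R (w i))
            \<partial>PiM {..<m} (\<lambda>_. unit_square))"
  proof (rule nn_integral_cong)
    fix w
    have "(\<Prod>i<m. indicator ?R ((w(m := z1, m + 1 := z2)) i) :: real) = (\<Prod>i<m. indicator ?R (w i))"
      by (rule prod.cong) auto
    hence K: "current_kernel x m (w(m := z1, m + 1 := z2)) = dirac_coeff m x ?u ?v *
        (\<Prod>i<m. indicator ?R (w i)) * indicator {0..?u} (fst z2) * indicator {0..?v} (snd z1)"
      unfolding current_kernel_eq by simp
    have prod: "(\<Prod>i<m. indicator ?R (w i) :: real) = (if \<forall>i<m. w i \<in> ?R then 1 else 0)"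
      "(\<Prod>i<m. indicator ?R (w i) :: ennreal) = (if \<forall>i<m. w i \<in> ?R then 1 else 0)"
      by (auto simp: indicator_def prod_zero_iff intro!: prod.neutral)
    show "ennreal (fact m * (current_kernel x m (w(m := z1, m + 1 := z2)))\<^sup>2) =
        ennreal (fact m * (dirac_coeff m x ?u ?v)\<^sup>2) * ?I * (\<Prod>i<m. indicator ?R (w i))"
      unfolding K prod by (auto simp: indicator_def)
  qed
  also have "\<dots> = ennreal (fact m * (dirac_coeff m x ?u ?v)\<^sup>2) * ?I *
      (\<integral>\<^sup>+w. (\<Prod>i<m. indicator ?R (w i)) \<partial>PiM {..<m} (\<lambda>_. unit_square))"
    by (rule nn_integral_cmult) measurable
  also have "(\<integral>\<^sup>+w. (\<Prod>i<m. indicator ?R (w i)) \<partial>PiM {..<m} (\<lambda>_. unit_square)) = ennreal ((?u * ?v) ^ m)"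
    using uv by (subst unit_square.product_nn_integral_prod)
      (auto simp: nn_integral_unit_square_rectangle ennreal_power)
  also have "ennreal (fact m * (dirac_coeff m x ?u ?v)\<^sup>2) * ?I * ennreal ((?u * ?v) ^ m) =
      ennreal (fact m * (dirac_coeff m x ?u ?v)\<^sup>2 * (?u * ?v) ^ m) * ?I"
    using uv by (subst ennreal_mult) (auto simp: mult_ac)
  also have "\<dots> \<le> ennreal (1 / sqrt (real m + 1) * inverse (?u * ?v)) * ?I"
    using uv by (intro mult_right_mono ennreal_leI dirac_coeff_bound) auto
  also have "\<dots> = ennreal (1 / sqrt (real m + 1)) * (ennreal (inverse (?u * ?v)) * ?I)"
    by (subst ennreal_mult') (auto simp: mult.assoc)
  finally show ?thesis .
qed

lemma nn_integral_current_kernel: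
  "ennreal (fact m) * (\<integral>\<^sup>+w. ennreal ((current_kernel x m w)\<^sup>2) \<partial>kernel_measure (m + 2))
     \<le> ennreal (1 / sqrt (real m + 1))"
proof -
  let ?P = "\<lambda>n. PiM {..<n} (\<lambda>_::nat. unit_square)"
  let ?f = "\<lambda>w. ennreal (fact m * (current_kernel x m w)\<^sup>2)"
  have ins: "{..<m + 2} = insert (m + 1) {..<m + 1}" "{..<m + 1} = insert m {..<m}" by auto
  have K: "current_kernel x m \<in> borel_measurable (PiM (insert (m + 1) {..<m + 1}) (\<lambda>_. unit_square))"
    using current_kernel_measurable[of x m] unfolding kernel_measure_def ins(1) .
  note [measurable] = K
  have "ennreal (fact m) * (\<integral>\<^sup>+w. ennreal ((current_kernel x m w)\<^sup>2) \<partial>kernel_measure (m + 2)) =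
      (\<integral>\<^sup>+w. ?f w \<partial>PiM (insert (m + 1) {..<m + 1}) (\<lambda>_. unit_square))"
    unfolding kernel_measure_def ins(1) ennreal_mult'[OF fact_ge_zero]
    by (rule nn_integral_cmult[symmetric]) measurable
  also have "\<dots> = (\<integral>\<^sup>+z2. \<integral>\<^sup>+w. ?f (w(m + 1 := z2)) \<partial>?P (m + 1) \<partial>unit_square)"
    by (rule unit_square.product_nn_integral_insert_rev, simp, simp, measurable)
  also have "\<dots> = (\<integral>\<^sup>+z2. \<integral>\<^sup>+z1. \<integral>\<^sup>+w. ?f (w(m := z1, m + 1 := z2)) \<partial>?P m \<partial>unit_square \<partial>unit_square)"
  proof (rule nn_integral_cong)
    fix z2 assume z2 [measurable]: "z2 \<in> space unit_square"
    have "(\<lambda>w. w(m + 1 := z2)) \<in> measurable (PiM {..<m + 1} (\<lambda>_. unit_square))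
        (PiM (insert (m + 1) {..<m + 1}) (\<lambda>_. unit_square))"
      by (rule measurable_fun_upd[where J = "{..<m + 1}"]) (use z2 in auto)
    from measurable_compose[OF this K]
    have [measurable]: "(\<lambda>w. current_kernel x m (w(m + 1 := z2))) \<in> borel_measurable
        (PiM (insert m {..<m}) (\<lambda>_. unit_square))" unfolding ins(2) .
    show "(\<integral>\<^sup>+w. ?f (w(m + 1 := z2)) \<partial>?P (m + 1)) =
        (\<integral>\<^sup>+z1. \<integral>\<^sup>+w. ?f (w(m := z1, m + 1 := z2)) \<partial>?P m \<partial>unit_square)"
      unfolding ins(2) by (rule unit_square.product_nn_integral_insert_rev, simp, simp, measurable)
  qed
  also have "\<dots> \<le> (\<integral>\<^sup>+z2. \<integral>\<^sup>+z1. ennreal (1 / sqrt (real m + 1)) * (ennreal (inverse (fst z1 * snd z2)) *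
      (indicator {0..fst z1} (fst z2) * indicator {0..snd z2} (snd z1))) \<partial>unit_square \<partial>unit_square)"
    by (intro nn_integral_mono nn_integral_current_kernel_inner) simp_all
  also have "\<dots> \<le> ennreal (1 / sqrt (real m + 1))" by (rule nn_integral_maximal_points)
  finally show ?thesis .
qed

section \<open>Norms of the chaos terms and summability\<close>

text \<open>The factor \<open>m! / (m + 2)!\<close> from symmetrization turns the weight \<open>(m + 2)!\<close> of the chaos norm
into the weight \<open>m!\<close> of the estimate for the unsymmetrized kernel.\<close>

lemma current_chaos_norm:
  shows "square_integrable (kernel_measure (m + 2)) (symmetrization (m + 2) (current_kernel x m))"
    and "fact (m + 2) * L2_norm_sq (kernel_measure (m + 2)) (symmetrization (m + 2) (current_kernel x m))
           \<le> 1 / sqrt (real m + 1)"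
proof -
  let ?K = "kernel_measure (m + 2)" and ?f = "symmetrization (m + 2) (current_kernel x m)"
  have meas [measurable]: "?f \<in> borel_measurable ?K"
    by (intro symmetrization_measurable current_kernel_measurable)
  have "ennreal (fact (m + 2)) * (\<integral>\<^sup>+w. ennreal ((?f w)\<^sup>2) \<partial>?K) =
      ennreal (fact (m + 2)) * (ennreal (fact m / fact (m + 2)) *
        (\<integral>\<^sup>+w. ennreal ((current_kernel x m w)\<^sup>2) \<partial>?K))"
    by (subst nn_integral_symmetrization_square[OF current_kernel_measurable _ current_kernel_orthogonal])
       (rule current_kernel_permute_agree, assumption+, rule refl)
  also have "\<dots> = ennreal (fact m) * (\<integral>\<^sup>+w. ennreal ((current_kernel x m w)\<^sup>2) \<partial>?K)"
  proof -
    have "ennreal (fact (m + 2)) * ennreal (fact m / fact (m + 2)) = ennreal (fact m)"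
      by (subst ennreal_mult[symmetric]) (auto simp del: fact_Suc)
    thus ?thesis by (simp only: mult.assoc[symmetric])
  qed
  also have "\<dots> \<le> ennreal (1 / sqrt (real m + 1))" by (rule nn_integral_current_kernel)
  finally have *: "ennreal (fact (m + 2)) * (\<integral>\<^sup>+w. ennreal ((?f w)\<^sup>2) \<partial>?K) \<le> ennreal (1 / sqrt (real m + 1))" .
  \<comment> \<open>finiteness comes from the same estimate\<close>
  have fin: "(\<integral>\<^sup>+w. ennreal ((?f w)\<^sup>2) \<partial>?K) < \<infinity>"
  proof (rule ccontr)
    assume "\<not> ?thesis"
    hence "(\<integral>\<^sup>+w. ennreal ((?f w)\<^sup>2) \<partial>?K) = \<infinity>" by (simp flip: less_top)
    hence "ennreal (fact (m + 2)) * (\<integral>\<^sup>+w. ennreal ((?f w)\<^sup>2) \<partial>?K) = \<infinity>"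
      by (simp only:) (simp add: ennreal_mult_top del: fact_Suc)
    with * show False by (simp add: top_unique del: fact_Suc)
  qed
  have int: "integrable ?K (\<lambda>w. (?f w)\<^sup>2)"
    by (rule integrableI_nonneg) (use fin meas in \<open>auto simp del: add_2_eq_Suc'\<close>)
  thus "square_integrable ?K ?f" using meas by (simp add: square_integrable_def)
  have "ennreal (fact (m + 2) * L2_norm_sq ?K ?f) =
      ennreal (fact (m + 2)) * (\<integral>\<^sup>+w. ennreal ((?f w)\<^sup>2) \<partial>?K)"
    using int unfolding L2_norm_sq_def
    by (subst nn_integral_eq_integral) (auto simp: ennreal_mult' simp del: fact_Suc)
  with * have "ennreal (fact (m + 2) * L2_norm_sq ?K ?f) \<le> ennreal (1 / sqrt (real m + 1))"
    by (simp only:)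
  thus "fact (m + 2) * L2_norm_sq ?K ?f \<le> 1 / sqrt (real m + 1)"
    by (subst (asm) ennreal_le_iff) auto
qed

lemma symmetric_kernel_symmetrization: "symmetric_kernel n (symmetrization n f)"
  by (simp add: symmetric_kernel_def symmetrization_permute)

text \<open>The series is shifted by two, where the orders zero and one are left out, and compared with
\<open>\<Sum> (m + 1) powr (- \<alpha> - 1 / 2)\<close>.\<close>

lemma current_chaos_summable:
  assumes a: "\<alpha> > 1 / 2"
  shows "summable (\<lambda>n. (1 + real n) powr (- \<alpha>) * fact n *
    L2_norm_sq (kernel_measure n) (double_skorohod (current_integrand x) n))" (is "summable ?s")
proof -
  have "summable (\<lambda>m. ?s (m + 2))"
  proof (rule summable_comparison_test')
    have "summable (\<lambda>n. real n powr (- \<alpha> - 1 / 2))" using a by (simp add: summable_real_powr_iff)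
    thus "summable (\<lambda>m. real (Suc m) powr (- \<alpha> - 1 / 2))" by (subst summable_Suc_iff)
    fix m :: nat
    let ?N = "L2_norm_sq (kernel_measure (m + 2)) (symmetrization (m + 2) (current_kernel x m))"
    have e: "?s (m + 2) = (1 + real (m + 2)) powr (- \<alpha>) * (fact (m + 2) * ?N)"
      by (simp only: add_2_eq_Suc' double_skorohod_current mult.assoc)
    have N: "0 \<le> ?N" by (simp add: L2_norm_sq_def)
    have "?s (m + 2) \<le> real (Suc m) powr (- \<alpha>) * (1 / sqrt (real m + 1))"
      unfolding e
    proof (rule mult_mono[OF _ current_chaos_norm(2)])
      show "(1 + real (m + 2)) powr (- \<alpha>) \<le> real (Suc m) powr (- \<alpha>)"
        using a by (intro powr_mono2') auto
    qed (use N in auto)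
    also have "\<dots> = real (Suc m) powr (- \<alpha> - 1 / 2)"
      by (simp add: powr_diff powr_half_sqrt add.commute)
    finally show "norm (?s (m + 2)) \<le> real (Suc m) powr (- \<alpha> - 1 / 2)"
      using N unfolding e by (simp add: abs_mult del: fact_Suc)
  qed
  thus ?thesis by (subst (asm) summable_iff_shift)
qed

theorem theorem1:
  fixes M :: "'a measure" and W :: "real \<Rightarrow> real \<Rightarrow> 'a \<Rightarrow> real"
  assumes "wiener_sheet M W"
  shows "\<forall>x::real. \<forall>\<alpha>::real. \<alpha> > 1 / 2 \<longrightarrow>
           stochastic_current M W x \<in> sobolev_watanabe M W (- \<alpha>)"
proof (intro allI impI)
  fix x \<alpha> :: real
  assume a: "\<alpha> > 1 / 2"
  let ?f = "double_skorohod (current_integrand x)"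
  have "square_integrable (kernel_measure n) (?f n) \<and> symmetric_kernel n (?f n)" for n
  proof (cases "n < 2")
    case True
    hence "?f n = (\<lambda>w. 0)" by (auto simp: less_2_cases_iff)
    thus ?thesis by (simp add: square_integrable_def symmetric_kernel_def)
  next
    case False
    then obtain m where n: "n = m + 2" by (metis add.commute le_Suc_ex not_less)
    have "?f n = symmetrization (m + 2) (current_kernel x m)"
      unfolding n add_2_eq_Suc' double_skorohod_current ..
    thus ?thesis unfolding n by (simp add: current_chaos_norm symmetric_kernel_symmetrization del: add_2_eq_Suc')
  qed
  thus "stochastic_current M W x \<in> sobolev_watanabe M W (- \<alpha>)"
    using current_chaos_summable[OF a, of x]
    unfolding sobolev_watanabe_def stochastic_current_def by blast
qed

end
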